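(* Let $R$ be a one-sided Duo ring, i.e. a ring that is Left Duo or Right Duo. Then $R$ is McCoy, i.e. both Left McCoy and Right McCoy: for all nonzero polynomials $f(x), g(x)\in R[x]$ with $f(x)g(x)=0$ there exist a nonzero $r\in R$ such that $f(x)r=0$ and a nonzero $s\in R$ such that $s\,g(x)=0$.
   Context: Rings are associative with unity, not necessarily commutative. $R[x]$ is the polynomial ring in one indeterminate $x$ that commutes with all elements of $R$. A ring $R$ is called Left Duo (resp. Right Duo) if every left (resp. right) ideal of $R$ is a two-sided ideal. A ring is one-sided Duo if it is Left Duo or Right Duo. A ring $R$ is Right McCoy if, for all nonzero $f(x), g(x)\in R[x]$, $f(x)g(x)=0$ implies that there exists a nonzero $r\in R$ with $f(x)r=0$; it is Left McCoy if, under the same conditions on $f(x)$ and $g(x)$, there exists a nonzero $s\in R$ with $s\,g(x)=0$. A ring is McCoy if it is both Left McCoy and Right McCoy. *)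

theory Defs
  imports "HOL-Algebra.UnivPoly" "HOL-Algebra.Ideal"
begin

definition left_ideal :: "'a set \<Rightarrow> ('a, 'm) ring_scheme \<Rightarrow> bool" where
  "left_ideal I R \<longleftrightarrow>
     additive_subgroup I R \<and> (\<forall>a\<in>carrier R. \<forall>x\<in>I. a \<otimes>\<^bsub>R\<^esub> x \<in> I)"

definition right_ideal :: "'a set \<Rightarrow> ('a, 'm) ring_scheme \<Rightarrow> bool" where
  "right_ideal I R \<longleftrightarrow>
     additive_subgroup I R \<and> (\<forall>a\<in>carrier R. \<forall>x\<in>I. x \<otimes>\<^bsub>R\<^esub> a \<in> I)"

definition left_duo :: "('a, 'm) ring_scheme \<Rightarrow> bool" where
  "left_duo R \<longleftrightarrow> (\<forall>I. left_ideal I R \<longrightarrow> ideal I R)"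

definition right_duo :: "('a, 'm) ring_scheme \<Rightarrow> bool" where
  "right_duo R \<longleftrightarrow> (\<forall>I. right_ideal I R \<longrightarrow> ideal I R)"

definition one_sided_duo :: "('a, 'm) ring_scheme \<Rightarrow> bool" where
  "one_sided_duo R \<longleftrightarrow> left_duo R \<or> right_duo R"

(* UP R is the polynomial ring in an indeterminate commuting with the coefficients; UnivPoly
   makes it a ring for every ring R, commutative or not.  An element r of R acts on
   polynomials from either side as the constant polynomial monom (UP R) r 0. *)

definition right_mccoy :: "('a, 'm) ring_scheme \<Rightarrow> bool" where
  "right_mccoy R \<longleftrightarrow>
     (\<forall>f\<in>carrier (UP R). \<forall>g\<in>carrier (UP R).
        f \<noteq> \<zero>\<^bsub>UP R\<^esub> \<longrightarrow> g \<noteq> \<zero>\<^bsub>UP R\<^esub> \<longrightarrow> f \<otimes>\<^bsub>UP R\<^esub> g = \<zero>\<^bsub>UP R\<^esub> \<longrightarrow>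
        (\<exists>r\<in>carrier R. r \<noteq> \<zero>\<^bsub>R\<^esub> \<and> f \<otimes>\<^bsub>UP R\<^esub> monom (UP R) r 0 = \<zero>\<^bsub>UP R\<^esub>))"

definition left_mccoy :: "('a, 'm) ring_scheme \<Rightarrow> bool" where
  "left_mccoy R \<longleftrightarrow>
     (\<forall>f\<in>carrier (UP R). \<forall>g\<in>carrier (UP R).
        f \<noteq> \<zero>\<^bsub>UP R\<^esub> \<longrightarrow> g \<noteq> \<zero>\<^bsub>UP R\<^esub> \<longrightarrow> f \<otimes>\<^bsub>UP R\<^esub> g = \<zero>\<^bsub>UP R\<^esub> \<longrightarrow>
        (\<exists>s\<in>carrier R. s \<noteq> \<zero>\<^bsub>R\<^esub> \<and> monom (UP R) s 0 \<otimes>\<^bsub>UP R\<^esub> g = \<zero>\<^bsub>UP R\<^esub>))"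

definition mccoy :: "('a, 'm) ring_scheme \<Rightarrow> bool" where
  "mccoy R \<longleftrightarrow> left_mccoy R \<and> right_mccoy R"

end

theory Submission
  imports Defs "HOL-Algebra.Ring_Divisibility"
begin

text \<open>
  Passing to the opposite ring exchanges the two duo conditions and the two factors of a product,
  so let \<open>R\<close> be right duo and \<open>f g = 0\<close> with \<open>f\<close>, \<open>g\<close> nonzero. Write \<open>a\<^sub>i\<close> and \<open>b\<^sub>j\<close> for the
  coefficients of \<open>f\<close> and \<open>g\<close>. Two properties replace commutativity. Since \<open>y R\<close> is two-sided,
  every product \<open>x y\<close> can be rewritten as \<open>y z\<close> (lemma \<open>exchange\<close>). Consequently \<open>x y = 0\<close>
  implies \<open>x R y = 0\<close> (lemma \<open>semicommutative\<close>). The two annihilators are found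
  in quite different ways.

  \<^emph>\<open>An annihilator of f.\<close> Go through the pairs \<open>(i, j)\<close> in lexicographic order and replace \<open>g\<close> by
  nonzero right multiples \<open>g s\<close>, which keeps \<open>f g = 0\<close>, until every product \<open>a\<^sub>i b\<^sub>j\<close> vanishes. If all
  earlier products vanish, the coefficient of \<open>f g\<close> of degree \<open>i + j\<close>, multiplied by \<open>a\<^sub>i\<close>, gives
  \<open>a\<^sub>i\<^sup>2 b\<^sub>j = 0\<close>. If \<open>a\<^sub>i b\<^sub>j\<close> is not zero, write it as \<open>b\<^sub>j s\<close>: then \<open>g s\<close> is nonzero, and
  \<open>a\<^sub>i b\<^sub>j s = a\<^sub>i\<^sup>2 b\<^sub>j = 0\<close>. At the end any nonzero coefficient of \<open>g\<close> annihilates \<open>f\<close>.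

  \<^emph>\<open>An annihilator of g.\<close> The same trick is not available, because the right duo condition does not
  turn \<open>a\<^sub>i b\<^sub>j\<close> into a left multiple of \<open>a\<^sub>i\<close>. Instead, every \<open>b\<^sub>j\<close> has a power that annihilates
  \<open>f\<close> from the right, which is a weak form of the Dedekind--Mertens lemma
  (\<open>coefficient_power_annihilates\<close>). Otherwise the ideal \<open>{r. f r = 0}\<close> lies in a completely prime
  ideal \<open>P\<close> that does not contain \<open>b\<^sub>j\<close>. Let \<open>k\<close> be least with \<open>b\<^sub>k \<notin> P\<close>. The equations for the
  coefficients of degree \<open>k\<close>, \<open>k + 1\<close>, ... form a square linear system for the \<open>a\<^sub>i\<close> which is
  triangular modulo \<open>P\<close>, with diagonal entry \<open>b\<^sub>k\<close>. Gaussian elimination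
  (\<open>triangular_elimination\<close>) yields \<open>u \<notin> P\<close> with \<open>f u = 0\<close>, a contradiction. Finally, multiply a
  nonzero \<open>a\<^sub>i\<close> from the right by the highest power of \<open>b\<^sub>0\<close> that keeps it nonzero, then by such a
  power of \<open>b\<^sub>1\<close>, and so on; the result is nonzero and annihilates every \<open>b\<^sub>j\<close>.
\<close>

section \<open>Right duo rings\<close>

locale right_duo_ring = ring R for R (structure) +
  assumes right_duo: "right_duo R"
begin

lemma right_ideal_imp_ideal:
  assumes "\<zero> \<in> I" "I \<subseteq> carrier R"
    and "\<And>x y. x \<in> I \<Longrightarrow> y \<in> I \<Longrightarrow> x \<oplus> y \<in> I"
    and "\<And>x r. x \<in> I \<Longrightarrow> r \<in> carrier R \<Longrightarrow> x \<otimes> r \<in> I"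
  shows "ideal I R"
proof -
  have neg: "\<ominus> x \<in> I" if "x \<in> I" for x
  proof -
    have "x \<otimes> (\<ominus> \<one>) \<in> I" using assms(4) that by auto
    moreover have "x \<otimes> (\<ominus> \<one>) = \<ominus> x" using that assms(2) by (auto simp: r_minus)
    ultimately show ?thesis by simp
  qed
  have "subgroup I (add_monoid R)"
    by (rule subgroup.intro) (use assms neg in \<open>auto simp flip: a_inv_def\<close>)
  then have "right_ideal I R"
    using assms(4) by (auto simp: right_ideal_def intro: additive_subgroupI)
  then show ?thesis using right_duo by (auto simp: right_duo_def)
qed

lemma exchange:
  assumes x: "x \<in> carrier R" and y: "y \<in> carrier R"
  obtains z where "z \<in> carrier R" "x \<otimes> y = y \<otimes> z"
proof -
  let ?I = "{y \<otimes> r | r. r \<in> carrier R}"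
  have "ideal ?I R"
  proof (rule right_ideal_imp_ideal)
    show "\<zero> \<in> ?I" using y by (auto intro!: exI[of _ \<zero>])
    show "?I \<subseteq> carrier R" using y by auto
    show "u \<oplus> v \<in> ?I" if "u \<in> ?I" "v \<in> ?I" for u v
      using that y by (auto simp flip: r_distr)
    show "u \<otimes> r \<in> ?I" if "u \<in> ?I" "r \<in> carrier R" for u r
      using that y by (auto simp: m_assoc)
  qed
  moreover have "y \<in> ?I" using y by (auto intro!: exI[of _ \<one>])
  ultimately have "x \<otimes> y \<in> ?I" using x by (rule ideal.I_l_closed)
  then show ?thesis using that by blast
qed

lemma semicommutative:
  assumes x: "x \<in> carrier R" and y: "y \<in> carrier R" and r: "r \<in> carrier R"
    and xy: "x \<otimes> y = \<zero>"
  shows "x \<otimes> (r \<otimes> y) = \<zero>"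
proof -
  obtain z where z: "z \<in> carrier R" "r \<otimes> y = y \<otimes> z" using exchange r y by blast
  have "x \<otimes> (r \<otimes> y) = (x \<otimes> y) \<otimes> z" using x y z by (simp add: m_assoc)
  then show ?thesis using xy z by simp
qed

text \<open>
  The ideal of all \<open>r\<close> with \<open>f r = 0\<close>, for \<open>f\<close> with coefficients \<open>a\<^sub>i\<close>. Over an
  arbitrary ring it is merely a right ideal.
\<close>

lemma ideal_right_annihilator:
  assumes a: "\<And>i. a i \<in> carrier R"
  shows "ideal {r \<in> carrier R. \<forall>i. a i \<otimes> r = \<zero>} R"
  by (rule right_ideal_imp_ideal) (use a in \<open>auto simp: r_distr simp flip: m_assoc\<close>)

lemma ideal_add_principal:
  assumes I: "ideal I R" and x: "x \<in> carrier R"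
  shows "ideal {p \<oplus> x \<otimes> r | p r. p \<in> I \<and> r \<in> carrier R} R" (is "ideal ?J R")
proof (rule right_ideal_imp_ideal)
  interpret I: ideal I R by (rule I)
  show "\<zero> \<in> ?J" using x I.zero_closed by (force intro!: exI[of _ \<zero>])
  show "?J \<subseteq> carrier R" using x I.Icarr by auto
  show "u \<oplus> v \<in> ?J" if uv: "u \<in> ?J" "v \<in> ?J" for u v
  proof -
    obtain p r q s where *: "u = p \<oplus> x \<otimes> r" "v = q \<oplus> x \<otimes> s"
      "p \<in> I" "q \<in> I" "r \<in> carrier R" "s \<in> carrier R"
      using uv by blast
    have "u \<oplus> v = (p \<oplus> q) \<oplus> x \<otimes> (r \<oplus> s)"
      using * x I.Icarr by (simp add: r_distr a_ac)
    then show ?thesis using * I.a_closed by blast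
  qed
  show "u \<otimes> t \<in> ?J" if ut: "u \<in> ?J" "t \<in> carrier R" for u t
  proof -
    obtain p r where *: "u = p \<oplus> x \<otimes> r" "p \<in> I" "r \<in> carrier R" using ut by blast
    have "u \<otimes> t = p \<otimes> t \<oplus> x \<otimes> (r \<otimes> t)"
      using * x I.Icarr ut by (simp add: l_distr m_assoc)
    then show ?thesis using * ut I.I_r_closed by blast
  qed
qed

end

section \<open>Products of polynomials, coefficientwise\<close>

text \<open>
  This is \<open>f g = 0\<close> in terms of coefficient sequences. Sequences rather than polynomials make the
  passage to the opposite ring a mere reindexing.
\<close>

definition (in ring) convolution_zero :: "(nat \<Rightarrow> 'a) \<Rightarrow> (nat \<Rightarrow> 'a) \<Rightarrow> bool" where
  "convolution_zero a b \<longleftrightarrow>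
     (\<forall>i. a i \<in> carrier R) \<and> (\<forall>j. b j \<in> carrier R) \<and>
     (\<forall>k. (\<Oplus>i\<in>{..k}. a i \<otimes> b (k - i)) = \<zero>)"

lemma (in ring) convolution_zero_mult_right:
  assumes "convolution_zero a b" and r: "r \<in> carrier R"
  shows "convolution_zero a (\<lambda>j. b j \<otimes> r)"
proof -
  have a: "\<And>i. a i \<in> carrier R" and b: "\<And>j. b j \<in> carrier R"
    and c: "\<And>k. (\<Oplus>i\<in>{..k}. a i \<otimes> b (k - i)) = \<zero>"
    using assms by (auto simp: convolution_zero_def)
  have "(\<Oplus>i\<in>{..k}. a i \<otimes> (b (k - i) \<otimes> r)) = \<zero>" for k
  proof -
    have "(\<Oplus>i\<in>{..k}. a i \<otimes> (b (k - i) \<otimes> r)) = (\<Oplus>i\<in>{..k}. a i \<otimes> b (k - i) \<otimes> r)"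
      using a b r by (intro finsum_cong') (auto simp: m_assoc)
    also have "\<dots> = (\<Oplus>i\<in>{..k}. a i \<otimes> b (k - i)) \<otimes> r"
      using a b r by (intro finsum_ldistr[symmetric]) auto
    finally show ?thesis using c r by simp
  qed
  then show ?thesis using a b r by (simp add: convolution_zero_def)
qed

lemma (in ring) finsum_eq_single:
  assumes "finite A" "i \<in> A" "f \<in> A \<rightarrow> carrier R" "\<And>j. j \<in> A \<Longrightarrow> j \<noteq> i \<Longrightarrow> f j = \<zero>"
  shows "(\<Oplus>j\<in>A. f j) = f i"
proof -
  have "(\<Oplus>j\<in>A. f j) = (\<Oplus>j\<in>A. if i = j then f j else \<zero>)"
    using assms by (intro finsum_cong') auto
  also have "\<dots> = f i" using assms by (intro add.finprod_singleton) auto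
  finally show ?thesis .
qed

section \<open>Annihilators of the left factor\<close>

context right_duo_ring
begin

text \<open>
  In the coefficient of degree \<open>i + l\<close>, the terms with a smaller left index vanish by hypothesis.
  Those with a larger left index have a smaller right index \<open>j\<close>; multiplication by \<open>a\<^sub>i\<close> kills them,
  since \<open>a\<^sub>i b\<^sub>j = 0\<close> implies \<open>a\<^sub>i R b\<^sub>j = 0\<close>.
\<close>

lemma square_coefficient_annihilates:
  assumes conv: "convolution_zero a b"
    and below: "\<And>i' j. i' < i \<Longrightarrow> a i' \<otimes> b j = \<zero>"
    and left: "\<And>j. j < l \<Longrightarrow> a i \<otimes> b j = \<zero>"
  shows "a i \<otimes> (a i \<otimes> b l) = \<zero>"
proof -
  have a: "\<And>i. a i \<in> carrier R" and b: "\<And>j. b j \<in> carrier R"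
    and c: "(\<Oplus>i'\<in>{..i + l}. a i' \<otimes> b (i + l - i')) = \<zero>"
    using conv by (auto simp: convolution_zero_def)
  have other: "a i \<otimes> (a i' \<otimes> b (i + l - i')) = \<zero>" if "i' \<in> {..i + l}" "i' \<noteq> i" for i'
  proof (cases "i' < i")
    case True
    then show ?thesis using below a by simp
  next
    case False
    then have "i + l - i' < l" using that by auto
    then show ?thesis using left semicommutative a b by blast
  qed
  have "(\<Oplus>i'\<in>{..i + l}. a i \<otimes> (a i' \<otimes> b (i + l - i')))
      = a i \<otimes> (\<Oplus>i'\<in>{..i + l}. a i' \<otimes> b (i + l - i'))"
    using a b by (intro finsum_rdistr[symmetric]) auto
  then have "(\<Oplus>i'\<in>{..i + l}. a i \<otimes> (a i' \<otimes> b (i + l - i'))) = \<zero>" using c a by simp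
  moreover have "(\<Oplus>i'\<in>{..i + l}. a i \<otimes> (a i' \<otimes> b (i + l - i')))
      = a i \<otimes> (a i \<otimes> b (i + l - i))"
    by (rule finsum_eq_single) (use a b other in auto)
  ultimately show ?thesis by simp
qed

text \<open>
  Whenever \<open>a\<^sub>i b\<^sub>l = b\<^sub>l s\<close> is not yet zero, \<open>s\<close> is the right multiplier to use: it keeps \<open>b\<^sub>l s\<close>
  nonzero, and \<open>a\<^sub>i b\<^sub>l s = a\<^sub>i\<^sup>2 b\<^sub>l\<close>, which the preceding lemma shows to be zero.
\<close>

lemma next_coefficient_annihilated:
  assumes conv: "convolution_zero a b" and nz: "\<exists>j. b j \<noteq> \<zero>"
    and below: "\<And>i' j. i' < i \<Longrightarrow> a i' \<otimes> b j = \<zero>"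
  shows "\<exists>r\<in>carrier R. (\<exists>j. b j \<otimes> r \<noteq> \<zero>) \<and> (\<forall>j<l. a i \<otimes> (b j \<otimes> r) = \<zero>)"
proof (induction l)
  case 0
  then show ?case using nz conv by (auto simp: convolution_zero_def intro!: bexI[of _ \<one>])
next
  case (Suc l)
  have a: "\<And>i. a i \<in> carrier R" and b: "\<And>j. b j \<in> carrier R"
    using conv by (auto simp: convolution_zero_def)
  obtain r where r: "r \<in> carrier R" "\<exists>j. b j \<otimes> r \<noteq> \<zero>" "\<And>j. j < l \<Longrightarrow> a i \<otimes> (b j \<otimes> r) = \<zero>"
    using Suc by auto
  show ?case
  proof (cases "a i \<otimes> (b l \<otimes> r) = \<zero>")
    case True
    then show ?thesis using r by (auto simp: less_Suc_eq)
  next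
    case False
    obtain s where s: "s \<in> carrier R" "a i \<otimes> (b l \<otimes> r) = (b l \<otimes> r) \<otimes> s"
      using exchange[of "a i" "b l \<otimes> r"] a b r by auto
    have sq: "a i \<otimes> (a i \<otimes> (b l \<otimes> r)) = \<zero>"
    proof (rule square_coefficient_annihilates)
      show "convolution_zero a (\<lambda>j. b j \<otimes> r)"
        using conv r(1) by (rule convolution_zero_mult_right)
      show "a i' \<otimes> (b j \<otimes> r) = \<zero>" if "i' < i" for i' j
        using below[OF that, of j] a b r(1) by (simp flip: m_assoc)
      show "a i \<otimes> (b j \<otimes> r) = \<zero>" if "j < l" for j using r that by auto
    qed
    have "b l \<otimes> (r \<otimes> s) \<noteq> \<zero>" using False s r b by (simp add: m_assoc)
    moreover have "a i \<otimes> (b j \<otimes> (r \<otimes> s)) = \<zero>" if "j < Suc l" for j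
    proof (cases "j = l")
      case True
      then show ?thesis using sq s r a b by (simp add: m_assoc)
    next
      case False
      then have "a i \<otimes> (b j \<otimes> r) \<otimes> s = \<zero>" using r that s by auto
      then show ?thesis using a b r s by (simp add: m_assoc)
    qed
    ultimately show ?thesis using r s by (intro bexI[of _ "r \<otimes> s"]) auto
  qed
qed

lemma right_multiple_annihilated:
  assumes conv: "convolution_zero a b" and nz: "\<exists>j. b j \<noteq> \<zero>"
    and fin: "\<And>j. n \<le> j \<Longrightarrow> b j = \<zero>"
  shows "\<exists>r\<in>carrier R. (\<exists>j. b j \<otimes> r \<noteq> \<zero>) \<and> (\<forall>i<m. \<forall>j. a i \<otimes> (b j \<otimes> r) = \<zero>)"
proof (induction m)
  case 0
  then show ?case using nz conv by (auto simp: convolution_zero_def intro!: bexI[of _ \<one>])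
next
  case (Suc m)
  have a: "\<And>i. a i \<in> carrier R" and b: "\<And>j. b j \<in> carrier R"
    using conv by (auto simp: convolution_zero_def)
  obtain r where r: "r \<in> carrier R" "\<exists>j. b j \<otimes> r \<noteq> \<zero>"
      "\<And>i j. i < m \<Longrightarrow> a i \<otimes> (b j \<otimes> r) = \<zero>"
    using Suc by auto
  obtain s where s: "s \<in> carrier R" "\<exists>j. b j \<otimes> r \<otimes> s \<noteq> \<zero>"
      "\<And>j. j < n \<Longrightarrow> a m \<otimes> (b j \<otimes> r \<otimes> s) = \<zero>"
    using next_coefficient_annihilated[OF convolution_zero_mult_right[OF conv r(1)] r(2,3), of m n]
    by auto
  have "a i \<otimes> (b j \<otimes> (r \<otimes> s)) = \<zero>" if "i < Suc m" for i j
  proof (cases "i = m")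
    case True
    then show ?thesis
      using s(1) s(3)[of j] fin[of j] a b r(1) by (cases "j < n") (auto simp: m_assoc)
  next
    case False
    then have "a i \<otimes> (b j \<otimes> r) \<otimes> s = \<zero>" using r s that by auto
    then show ?thesis using a b r s by (simp add: m_assoc)
  qed
  moreover have "\<exists>j. b j \<otimes> (r \<otimes> s) \<noteq> \<zero>" using s b r by (auto simp: m_assoc)
  ultimately show ?case using r s by (intro bexI[of _ "r \<otimes> s"]) auto
qed

theorem left_factor_annihilated:
  assumes conv: "convolution_zero a b" and nz: "\<exists>j. b j \<noteq> \<zero>"
    and fin: "\<And>i. m \<le> i \<Longrightarrow> a i = \<zero>" "\<And>j. n \<le> j \<Longrightarrow> b j = \<zero>"
  shows "\<exists>r\<in>carrier R. r \<noteq> \<zero> \<and> (\<forall>i. a i \<otimes> r = \<zero>)"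
proof -
  have b: "\<And>j. b j \<in> carrier R" using conv by (auto simp: convolution_zero_def)
  obtain r j where r: "r \<in> carrier R" "b j \<otimes> r \<noteq> \<zero>"
      "\<And>i j. i < m \<Longrightarrow> a i \<otimes> (b j \<otimes> r) = \<zero>"
    using right_multiple_annihilated[OF conv nz fin(2), of n m] by auto
  have "a i \<otimes> (b j \<otimes> r) = \<zero>" for i
    using r fin(1)[of i] b by (cases "i < m") auto
  then show ?thesis using r b by blast
qed

section \<open>Completely prime ideals\<close>

text \<open>
  As in the commutative case, an ideal that is maximal among those avoiding the powers of \<open>b\<close> is
  prime. Here it is even completely prime: the ideals generated by \<open>P\<close> together with \<open>x\<close> and with
  \<open>y\<close> consist of the elements \<open>p + x r\<close> and \<open>q + y s\<close>, and the product \<open>x r y s\<close> equals \<open>x y t s\<close>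
  for a suitable \<open>t\<close>, so that it lies in \<open>P\<close> as soon as \<open>x y\<close> does.
\<close>

lemma ideal_avoiding_powers:
  assumes Q: "ideal Q R" and b: "b \<in> carrier R" and avoid: "\<And>n::nat. b [^] n \<notin> Q"
  obtains P where "ideal P R" "Q \<subseteq> P" "b \<notin> P"
    "\<And>x y. x \<in> carrier R \<Longrightarrow> y \<in> carrier R \<Longrightarrow> x \<otimes> y \<in> P \<Longrightarrow> x \<in> P \<or> y \<in> P"
proof -
  let ?A = "{I. ideal I R \<and> Q \<subseteq> I \<and> (\<forall>n::nat. b [^] n \<notin> I)}"
  have "\<exists>P\<in>?A. \<forall>I\<in>?A. P \<subseteq> I \<longrightarrow> I = P"
  proof (rule subset_Zorn_nonempty)
    show "?A \<noteq> {}" using Q avoid by auto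
  next
    fix C assume C: "C \<noteq> {}" "subset.chain ?A C"
    then have "subset.chain {I. ideal I R} C" by (auto simp: pred_on.chain_def)
    then have "ideal (\<Union>C) R" using chain_Union_is_ideal[of C] C by simp
    then show "\<Union>C \<in> ?A" using C by (fastforce simp: pred_on.chain_def)
  qed
  then obtain P where PA: "P \<in> ?A" and max: "\<forall>I\<in>?A. P \<subseteq> I \<longrightarrow> I = P"
    by (elim bexE) (rule that)
  then have P: "ideal P R" "Q \<subseteq> P" "\<And>n::nat. b [^] n \<notin> P" by simp_all
  interpret P: ideal P R by (rule P)
  have meets: "\<exists>p r. \<exists>n::nat. p \<in> P \<and> r \<in> carrier R \<and> b [^] n = p \<oplus> x \<otimes> r"
    if x: "x \<in> carrier R" "x \<notin> P" for x
  proof (rule ccontr)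
    assume none: "\<not> ?thesis"
    let ?J = "{p \<oplus> x \<otimes> r | p r. p \<in> P \<and> r \<in> carrier R}"
    have sub: "P \<subseteq> ?J"
    proof
      fix p assume "p \<in> P"
      then have "p = p \<oplus> x \<otimes> \<zero>" using x P.Icarr by simp
      then show "p \<in> ?J" using \<open>p \<in> P\<close> by blast
    qed
    have JA: "?J \<in> ?A" using ideal_add_principal[OF P(1) x(1)] sub P(2) none by auto
    have "?J = P" by (rule max[rule_format, OF JA sub])
    moreover have "x = \<zero> \<oplus> x \<otimes> \<one>" using x by simp
    then have "x \<in> ?J" using P.zero_closed by blast
    ultimately show False using x by simp
  qed
  have "x \<in> P \<or> y \<in> P" if x: "x \<in> carrier R" and y: "y \<in> carrier R" and xy: "x \<otimes> y \<in> P" for x y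
  proof (rule ccontr)
    assume "\<not> ?thesis"
    then have "x \<notin> P" "y \<notin> P" by auto
    then obtain p r n q s k where 1: "p \<in> P" "r \<in> carrier R" "b [^] (n::nat) = p \<oplus> x \<otimes> r"
      and 2: "q \<in> P" "s \<in> carrier R" "b [^] (k::nat) = q \<oplus> y \<otimes> s"
      using meets x y by metis
    obtain t where t: "t \<in> carrier R" "r \<otimes> y = y \<otimes> t" using exchange 1(2) y by blast
    have xr: "x \<otimes> r \<otimes> (y \<otimes> s) = (x \<otimes> y) \<otimes> (t \<otimes> s)"
    proof -
      have "x \<otimes> r \<otimes> (y \<otimes> s) = x \<otimes> (r \<otimes> y) \<otimes> s" using x y 1 2 by (simp add: m_assoc)
      then show ?thesis using t x y 2 by (simp add: m_assoc)
    qed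
    have xrb: "(x \<otimes> r) \<otimes> b [^] k = (x \<otimes> r) \<otimes> q \<oplus> (x \<otimes> y) \<otimes> (t \<otimes> s)"
      unfolding 2(3) using 1 2 x y P.Icarr by (simp add: r_distr xr)
    have "b [^] (n + k) = (p \<oplus> x \<otimes> r) \<otimes> b [^] k"
      using b 1(3) by (simp flip: nat_pow_mult)
    also have "\<dots> = p \<otimes> b [^] k \<oplus> (x \<otimes> r) \<otimes> b [^] k"
      using 1 x b P.Icarr by (intro l_distr) auto
    also have "\<dots> = p \<otimes> b [^] k \<oplus> ((x \<otimes> r) \<otimes> q \<oplus> (x \<otimes> y) \<otimes> (t \<otimes> s))"
      by (simp only: xrb)
    also have "\<dots> \<in> P"
      using 1 2 x y b t xy P.I_l_closed P.I_r_closed by (intro P.a_closed) auto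
    finally show False using P(3) by simp
  qed
  moreover have "b \<notin> P" using P(3)[of 1] b by simp
  ultimately show ?thesis using that P by blast
qed

section \<open>Annihilators of the right factor\<close>

text \<open>
  Modulo \<open>P\<close> the matrix is triangular with nonzero diagonal entries over a ring without zero
  divisors; if the ring were commutative, its determinant could serve as \<open>u\<close>. Over a right duo ring
  the last unknown \<open>a\<^sub>n\<close> is eliminated by hand. With \<open>u = M\<^sub>n\<^sub>n\<close> and \<open>M\<^sub>n\<^sub>i u = u c\<^sub>i\<close>, subtracting the last
  equation times \<open>c\<^sub>i\<close> from the \<open>i\<close>-th equation times \<open>u\<close> removes \<open>a\<^sub>n\<close>.
\<close>

lemma triangular_elimination:
  fixes a :: "nat \<Rightarrow> 'a" and M :: "nat \<Rightarrow> nat \<Rightarrow> 'a"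
  assumes P: "ideal P R" "\<one> \<notin> P"
    and prime: "\<And>x y. x \<in> carrier R \<Longrightarrow> y \<in> carrier R \<Longrightarrow> x \<otimes> y \<in> P \<Longrightarrow> x \<in> P \<or> y \<in> P"
    and a: "\<And>i. a i \<in> carrier R"
    and "\<And>j i. M j i \<in> carrier R"
    and "\<And>i. i < n \<Longrightarrow> (\<Oplus>j\<in>{..<n}. a j \<otimes> M j i) = \<zero>"
    and "\<And>i. i < n \<Longrightarrow> M i i \<notin> P"
    and "\<And>j i. i < j \<Longrightarrow> j < n \<Longrightarrow> M j i \<in> P"
  shows "\<exists>u\<in>carrier R. u \<notin> P \<and> (\<forall>i<n. a i \<otimes> u = \<zero>)"
  using assms(5-8)
proof (induction n arbitrary: M)
  case 0
  then show ?case using P by (intro bexI[of _ \<one>]) auto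
next
  case (Suc n)
  interpret P: ideal P R by (rule P)
  note M = Suc.prems(1)
  define u where "u = M n n"
  have u: "u \<in> carrier R" "u \<notin> P" using Suc.prems(3)[of n] M by (auto simp: u_def)
  have "\<exists>z. z \<in> carrier R \<and> M n i \<otimes> u = u \<otimes> z" for i
    by (rule exchange[OF M[of n i] u(1)]) blast
  then obtain c where c: "\<And>i. c i \<in> carrier R" "\<And>i. M n i \<otimes> u = u \<otimes> c i" by metis
  \<comment> \<open>Complete primality carries membership in P from M n i over to c i: the exchange by itself only
    gives that the product of u and c i lies in P, and the new matrix has multiples of c i in all
    its entries.\<close>
  have cP: "c i \<in> P" if "i < n" for i
  proof -
    have "M n i \<in> P" using Suc.prems(4) that by auto
    then have "u \<otimes> c i \<in> P" using P.I_r_closed u(1) c(2)[of i] by metis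
    then show ?thesis using prime u c by blast
  qed
  define N where "N j i = M j i \<otimes> u \<ominus> M j n \<otimes> c i" for j i
  have N: "N j i \<in> carrier R" for j i using M u c by (simp add: N_def)
  have split: "(\<Oplus>j\<in>{..<n}. a j \<otimes> M j i) = \<ominus> (a n \<otimes> M n i)" if "i < Suc n" for i
  proof -
    have "(\<Oplus>j\<in>{..<Suc n}. a j \<otimes> M j i) = (\<Oplus>j\<in>{..<n}. a j \<otimes> M j i) \<oplus> a n \<otimes> M n i"
      using a M by (simp add: lessThan_Suc a_comm)
    then have "(\<Oplus>j\<in>{..<n}. a j \<otimes> M j i) \<oplus> a n \<otimes> M n i = \<zero>" using Suc.prems(2) that by simp
    then show ?thesis using a M by (intro minus_equality[symmetric]) auto
  qed
  have "\<exists>v\<in>carrier R. v \<notin> P \<and> (\<forall>i<n. a i \<otimes> v = \<zero>)"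
  proof (rule Suc.IH)
    show "N j i \<in> carrier R" for j i by (rule N)
    show "(\<Oplus>j\<in>{..<n}. a j \<otimes> N j i) = \<zero>" if i: "i < n" for i
    proof -
      have "(\<Oplus>j\<in>{..<n}. a j \<otimes> N j i)
          = (\<Oplus>j\<in>{..<n}. a j \<otimes> M j i \<otimes> u \<oplus> a j \<otimes> M j n \<otimes> (\<ominus> c i))"
        using a M u c by (intro finsum_cong') (auto simp: N_def minus_eq r_distr r_minus m_assoc)
      also have "\<dots> = (\<Oplus>j\<in>{..<n}. a j \<otimes> M j i) \<otimes> u \<oplus> (\<Oplus>j\<in>{..<n}. a j \<otimes> M j n) \<otimes> (\<ominus> c i)"
        using a M u c by (simp add: finsum_addf finsum_ldistr Pi_def)
      also have "\<dots> = \<ominus> (a n \<otimes> M n i) \<otimes> u \<oplus> \<ominus> (a n \<otimes> u) \<otimes> (\<ominus> c i)"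
        using split i by (simp add: u_def)
      also have "\<dots> = \<ominus> (a n \<otimes> (M n i \<otimes> u)) \<oplus> a n \<otimes> (u \<otimes> c i)"
        using a M u c by (simp add: l_minus r_minus m_assoc)
      also have "\<dots> = \<zero>" using a u c by (simp add: l_neg)
      finally show ?thesis .
    qed
    show "N i i \<notin> P" if i: "i < n" for i
    proof
      assume "N i i \<in> P"
      moreover have "M i n \<otimes> c i \<in> P" using cP i M P.I_l_closed by blast
      ultimately have "N i i \<oplus> M i n \<otimes> c i \<in> P" by (rule P.a_closed)
      moreover have "N i i \<oplus> M i n \<otimes> c i = M i i \<otimes> u"
        using M u c by (simp add: N_def minus_eq a_assoc l_neg)
      ultimately show False using prime[OF M u(1)] u(2) Suc.prems(3) i by (metis less_SucI)
    qed
    show "N j i \<in> P" if "i < j" "j < n" for j i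
    proof -
      have "M j i \<otimes> u \<in> P" using Suc.prems(4) that u P.I_r_closed by simp
      moreover have "M j n \<otimes> c i \<in> P" using cP that M P.I_l_closed by simp
      ultimately show ?thesis unfolding N_def minus_eq
        by (intro P.a_closed P.a_inv_closed)
    qed
  qed
  then obtain v where v: "v \<in> carrier R" "v \<notin> P" "\<And>i. i < n \<Longrightarrow> a i \<otimes> v = \<zero>" by blast
  \<comment> \<open>The last equation expresses a n u through the other unknowns, which v annihilates.\<close>
  have kill: "a i \<otimes> (y \<otimes> v) = \<zero>" if "i < n" "y \<in> carrier R" for i y
    using semicommutative a v that by blast
  have "a n \<otimes> (u \<otimes> v) = \<zero>"
  proof -
    have "(\<Oplus>j\<in>{..<n}. a j \<otimes> M j n) \<otimes> v = (\<Oplus>j\<in>{..<n}. a j \<otimes> M j n \<otimes> v)"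
      using a M v by (intro finsum_ldistr) auto
    also have "\<dots> = (\<Oplus>j\<in>{..<n}. \<zero>)"
      using a M v kill by (intro finsum_cong') (auto simp: m_assoc)
    finally have "\<ominus> (a n \<otimes> u) \<otimes> v = \<zero>" using split[of n] by (simp add: u_def)
    then have "\<ominus> (a n \<otimes> (u \<otimes> v)) = \<zero>" using a u v by (simp add: l_minus m_assoc)
    then show ?thesis using a u v by (metis m_closed minus_minus minus_zero)
  qed
  then have "\<forall>i<Suc n. a i \<otimes> (u \<otimes> v) = \<zero>" using kill u by (auto simp: less_Suc_eq)
  moreover have "u \<otimes> v \<notin> P" using prime u v by blast
  ultimately show ?case using u v by blast
qed

text \<open>
  If no power of \<open>b\<^sub>j\<close> annihilates \<open>f\<close>, separate the powers of \<open>b\<^sub>j\<close> from the right annihilator of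
  \<open>f\<close> by a completely prime ideal; elimination then produces an annihilator outside that ideal.
\<close>

lemma coefficient_power_annihilates:
  assumes conv: "convolution_zero a b" and fin: "\<And>i. m \<le> i \<Longrightarrow> a i = \<zero>"
  shows "\<exists>n::nat. \<forall>i. a i \<otimes> b j [^] n = \<zero>"
proof (rule ccontr)
  assume none: "\<not> ?thesis"
  have a: "\<And>i. a i \<in> carrier R" and b: "\<And>j. b j \<in> carrier R"
    and c: "\<And>k. (\<Oplus>i\<in>{..k}. a i \<otimes> b (k - i)) = \<zero>"
    using conv by (auto simp: convolution_zero_def)
  let ?Q = "{r \<in> carrier R. \<forall>i. a i \<otimes> r = \<zero>}"
  have avoid: "b j [^] n \<notin> ?Q" for n :: nat using none by auto
  obtain P where P: "ideal P R" "?Q \<subseteq> P" "b j \<notin> P"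
    and prime: "\<And>x y. x \<in> carrier R \<Longrightarrow> y \<in> carrier R \<Longrightarrow> x \<otimes> y \<in> P \<Longrightarrow> x \<in> P \<or> y \<in> P"
    by (rule ideal_avoiding_powers[OF ideal_right_annihilator[of a, OF a] b[of j] avoid])
      (rule that)
  interpret P: ideal P R by (rule P)
  define k where "k = (LEAST k. b k \<notin> P)"
  have k: "b k \<notin> P" unfolding k_def using P(3) by (rule LeastI)
  have below: "b i \<in> P" if "i < k" for i using not_less_Least that unfolding k_def by blast
  \<comment> \<open>Column i holds the multipliers of the unknowns in the coefficient of degree i + k; if the index
    i' of the unknown exceeds i, the multiplier is zero or a coefficient of index less than k.\<close>
  define M where "M i' i = (if i' \<le> i + k then b (i + k - i') else \<zero>)" for i' i
  have "\<exists>u\<in>carrier R. u \<notin> P \<and> (\<forall>i<m. a i \<otimes> u = \<zero>)"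
  proof (rule triangular_elimination[where M = M])
    show "ideal P R" by (rule P)
    show "\<one> \<notin> P" using P(3) P.one_imp_carrier b by auto
    show "\<And>x y. x \<in> carrier R \<Longrightarrow> y \<in> carrier R \<Longrightarrow> x \<otimes> y \<in> P \<Longrightarrow> x \<in> P \<or> y \<in> P"
      by (rule prime)
    show "\<And>i. a i \<in> carrier R" by (rule a)
    show "M i' i \<in> carrier R" for i' i using b by (simp add: M_def)
    show "(\<Oplus>i'\<in>{..<m}. a i' \<otimes> M i' i) = \<zero>" if "i < m" for i
    proof -
      have "(\<Oplus>i'\<in>{..<m}. a i' \<otimes> M i' i) = (\<Oplus>i'\<in>{..<m} \<union> {..i + k}. a i' \<otimes> M i' i)"
        using a b fin by (intro add.finprod_mono_neutral_cong_left) (auto simp: M_def)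
      also have "\<dots> = (\<Oplus>i'\<in>{..i + k}. a i' \<otimes> b (i + k - i'))"
        using a b fin by (intro add.finprod_mono_neutral_cong_right) (auto simp: M_def)
      finally show ?thesis using c by simp
    qed
    show "M i i \<notin> P" for i using k by (simp add: M_def)
    show "M i' i \<in> P" if "i < i'" for i' i
      using that below P.zero_closed by (simp add: M_def)
  qed
  then obtain u where u: "u \<in> carrier R" "u \<notin> P" "\<And>i. i < m \<Longrightarrow> a i \<otimes> u = \<zero>" by blast
  have "a i \<otimes> u = \<zero>" for i using u fin[of i] by (cases "i < m") auto
  then have "u \<in> ?Q" using u by blast
  then show False using u P by blast
qed

text \<open>
  Right multiplication of \<open>c\<close> by the last power of \<open>b\<^sub>n\<close> that keeps it nonzero makes it annihilate
  \<open>b\<^sub>n\<close>. By semicommutativity this destroys neither \<open>c b\<^sub>j = 0\<close> for earlier \<open>j\<close> nor the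
  annihilation by powers of later \<open>b\<^sub>j\<close>.
\<close>

lemma common_left_annihilator:
  fixes b :: "nat \<Rightarrow> 'a"
  assumes "c \<in> carrier R" "c \<noteq> \<zero>" and b: "\<And>j. b j \<in> carrier R"
    and nil: "\<And>j. j < n \<Longrightarrow> \<exists>k::nat. c \<otimes> b j [^] k = \<zero>"
  shows "\<exists>s\<in>carrier R. s \<noteq> \<zero> \<and> (\<forall>j<n. s \<otimes> b j = \<zero>)"
proof -
  have "\<exists>r\<in>carrier R. c \<otimes> r \<noteq> \<zero> \<and> (\<forall>j<n. c \<otimes> r \<otimes> b j = \<zero>)"
    using nil
  proof (induction n)
    case 0
    then show ?case using assms by (intro bexI[of _ \<one>]) auto
  next
    case (Suc n)
    obtain r where r: "r \<in> carrier R" "c \<otimes> r \<noteq> \<zero>" "\<And>j. j < n \<Longrightarrow> c \<otimes> r \<otimes> b j = \<zero>"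
      using Suc by auto
    obtain k :: nat where "c \<otimes> b n [^] k = \<zero>" using Suc.prems by blast
    then have "c \<otimes> (r \<otimes> b n [^] k) = \<zero>" using semicommutative assms b r by simp
    then have ex: "c \<otimes> r \<otimes> b n [^] k = \<zero>" using assms b r by (simp add: m_assoc)
    define l where "l = (LEAST k::nat. c \<otimes> r \<otimes> b n [^] k = \<zero>)"
    have l: "c \<otimes> r \<otimes> b n [^] l = \<zero>" unfolding l_def using ex by (rule LeastI)
    have "l \<noteq> 0" using l r assms by (cases l) auto
    then obtain p where p: "l = Suc p" by (cases l) auto
    have nz: "c \<otimes> r \<otimes> b n [^] p \<noteq> \<zero>" 
      using not_less_Least[of p "\<lambda>k. c \<otimes> r \<otimes> b n [^] k = \<zero>"] p by (simp flip: l_def)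
    have "c \<otimes> r \<otimes> b n [^] p \<otimes> b j = \<zero>" if "j < Suc n" for j
    proof (cases "j = n")
      case True
      then show ?thesis using l p assms b r by (simp add: m_assoc)
    next
      case False
      then have "c \<otimes> r \<otimes> (b n [^] p \<otimes> b j) = \<zero>"
        using semicommutative r(3)[of j] that assms b r(1) by simp
      then show ?thesis using assms b r by (simp add: m_assoc)
    qed
    then show ?case using nz r assms b
      by (intro bexI[of _ "r \<otimes> b n [^] p"]) (auto simp: m_assoc)
  qed
  then show ?thesis using assms by blast
qed

theorem right_factor_annihilated:
  assumes conv: "convolution_zero a b" and nz: "\<exists>i. a i \<noteq> \<zero>"
    and fin: "\<And>i. m \<le> i \<Longrightarrow> a i = \<zero>" "\<And>j. n \<le> j \<Longrightarrow> b j = \<zero>"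
  shows "\<exists>s\<in>carrier R. s \<noteq> \<zero> \<and> (\<forall>j. s \<otimes> b j = \<zero>)"
proof -
  have a: "\<And>i. a i \<in> carrier R" and b: "\<And>j. b j \<in> carrier R"
    using conv by (auto simp: convolution_zero_def)
  obtain i where i: "a i \<noteq> \<zero>" using nz by blast
  have "\<exists>k::nat. a i \<otimes> b j [^] k = \<zero>" for j
    using coefficient_power_annihilates[OF conv fin(1)] by blast
  then obtain s where s: "s \<in> carrier R" "s \<noteq> \<zero>" "\<And>j. j < n \<Longrightarrow> s \<otimes> b j = \<zero>"
    using common_left_annihilator[of "a i" b n] a b i by blast
  have "s \<otimes> b j = \<zero>" for j using s fin(2)[of j] by (cases "j < n") auto
  then show ?thesis using s by blast
qed

end

section \<open>The opposite ring\<close>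

definition opposite :: "('a, 'm) ring_scheme \<Rightarrow> ('a, 'm) ring_scheme" where
  "opposite R = R\<lparr>mult := \<lambda>x y. y \<otimes>\<^bsub>R\<^esub> x\<rparr>"

lemma opposite_simps [simp]:
  "carrier (opposite R) = carrier R" "x \<otimes>\<^bsub>opposite R\<^esub> y = y \<otimes>\<^bsub>R\<^esub> x"
  "\<one>\<^bsub>opposite R\<^esub> = \<one>\<^bsub>R\<^esub>" "\<zero>\<^bsub>opposite R\<^esub> = \<zero>\<^bsub>R\<^esub>" "(\<oplus>\<^bsub>opposite R\<^esub>) = (\<oplus>\<^bsub>R\<^esub>)"
  by (simp_all add: opposite_def)

lemma finsum_opposite [simp]: "finsum (opposite R) f A = finsum R f A"
  by (simp add: finsum_def)

lemma ring_opposite: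
  assumes "ring R" shows "ring (opposite R)"
proof -
  interpret ring R by (rule assms)
  show ?thesis
  proof (rule ringI)
    show "abelian_group (opposite R)"
      by (rule abelian_groupI) (use l_neg in \<open>auto simp: a_ac\<close>)
    show "Group.monoid (opposite R)" by (rule monoidI) (auto simp: m_assoc)
  qed (auto simp: l_distr r_distr)
qed

lemma ideal_opposite:
  assumes "ring R" "ideal I R" shows "ideal I (opposite R)"
  using assms ring_opposite[OF assms(1)] by (simp add: ideal_def additive_subgroup_def ideal_axioms_def)

lemma right_duo_opposite:
  assumes "ring R" "left_duo R" shows "right_duo (opposite R)"
  using assms by (auto simp: right_duo_def left_duo_def right_ideal_def left_ideal_def
      additive_subgroup_def intro!: ideal_opposite)

lemma (in ring) convolution_zero_opposite:
  assumes "convolution_zero a b" shows "ring.convolution_zero (opposite R) b a"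
proof -
  have a: "\<And>i. a i \<in> carrier R" and b: "\<And>j. b j \<in> carrier R"
    and c: "\<And>k. (\<Oplus>i\<in>{..k}. a i \<otimes> b (k - i)) = \<zero>"
    using assms by (auto simp: convolution_zero_def)
  have "(\<Oplus>i\<in>{..k}. a (k - i) \<otimes> b i) = \<zero>" for k
  proof -
    have inj: "inj_on (\<lambda>i. k - i) {..k}" by (auto simp: inj_on_def)
    have img: "(\<lambda>i. k - i) ` {..k} = {..k}"
    proof
      show "{..k} \<subseteq> (\<lambda>i. k - i) ` {..k}"
      proof
        fix i assume "i \<in> {..k}"
        then have "i = k - (k - i)" "k - i \<in> {..k}" by auto
        then show "i \<in> (\<lambda>i. k - i) ` {..k}" by (rule image_eqI)
      qed
    qed auto
    have "(\<Oplus>i\<in>(\<lambda>i. k - i) ` {..k}. a i \<otimes> b (k - i)) = (\<Oplus>i\<in>{..k}. a (k - i) \<otimes> b (k - (k - i)))"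
      using a b inj by (intro add.finprod_reindex) auto
    also have "\<dots> = (\<Oplus>i\<in>{..k}. a (k - i) \<otimes> b i)"
      using a b by (intro finsum_cong') auto
    finally show ?thesis using c img by simp
  qed
  then show ?thesis
    using a b ring_opposite[OF ring_axioms] by (simp add: ring.convolution_zero_def)
qed

section \<open>One-sided duo rings are McCoy\<close>

text \<open>
  Multiplying by a constant polynomial multiplies each coefficient, so the McCoy conditions only
  concern coefficient sequences. Both are treated at once because one application of the opposite
  ring supplies both.
\<close>

lemma mccoy_if_coefficients:
  assumes "ring R"
    and ann: "\<And>a b m n. \<lbrakk>ring.convolution_zero R a b; \<exists>i. a i \<noteq> \<zero>\<^bsub>R\<^esub>; \<exists>j. b j \<noteq> \<zero>\<^bsub>R\<^esub>;
        \<And>i. m \<le> i \<Longrightarrow> a i = \<zero>\<^bsub>R\<^esub>; \<And>j. n \<le> j \<Longrightarrow> b j = \<zero>\<^bsub>R\<^esub>\<rbrakk> \<Longrightarrow>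
        (\<exists>r\<in>carrier R. r \<noteq> \<zero>\<^bsub>R\<^esub> \<and> (\<forall>i. a i \<otimes>\<^bsub>R\<^esub> r = \<zero>\<^bsub>R\<^esub>)) \<and>
        (\<exists>s\<in>carrier R. s \<noteq> \<zero>\<^bsub>R\<^esub> \<and> (\<forall>j. s \<otimes>\<^bsub>R\<^esub> b j = \<zero>\<^bsub>R\<^esub>))"
  shows "mccoy R"
proof -
  interpret UP_ring R "UP R" using assms(1) by (simp add: UP_ring_def)
  have "(\<exists>r\<in>carrier R. r \<noteq> \<zero>\<^bsub>R\<^esub> \<and> f \<otimes>\<^bsub>UP R\<^esub> monom (UP R) r 0 = \<zero>\<^bsub>UP R\<^esub>) \<and>
        (\<exists>s\<in>carrier R. s \<noteq> \<zero>\<^bsub>R\<^esub> \<and> monom (UP R) s 0 \<otimes>\<^bsub>UP R\<^esub> g = \<zero>\<^bsub>UP R\<^esub>)"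
    if f: "f \<in> carrier (UP R)" "f \<noteq> \<zero>\<^bsub>UP R\<^esub>" and g: "g \<in> carrier (UP R)" "g \<noteq> \<zero>\<^bsub>UP R\<^esub>"
      and fg: "f \<otimes>\<^bsub>UP R\<^esub> g = \<zero>\<^bsub>UP R\<^esub>" for f g
  proof -
    let ?a = "coeff (UP R) f" and ?b = "coeff (UP R) g"
    have "(\<Oplus>\<^bsub>R\<^esub>i\<in>{..k}. ?a i \<otimes>\<^bsub>R\<^esub> ?b (k - i)) = \<zero>\<^bsub>R\<^esub>" for k
      using coeff_mult[OF f(1) g(1), of k] fg by simp
    then have "R.convolution_zero ?a ?b" using f g by (simp add: R.convolution_zero_def)
    moreover have "\<exists>i. ?a i \<noteq> \<zero>\<^bsub>R\<^esub>" using f up_eqI[of f "\<zero>\<^bsub>UP R\<^esub>"] by auto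
    moreover have "\<exists>i. ?b i \<noteq> \<zero>\<^bsub>R\<^esub>" using g up_eqI[of g "\<zero>\<^bsub>UP R\<^esub>"] by auto
    moreover have "?a i = \<zero>\<^bsub>R\<^esub>" if "Suc (deg R f) \<le> i" for i using deg_aboveD f that by auto
    moreover have "?b i = \<zero>\<^bsub>R\<^esub>" if "Suc (deg R g) \<le> i" for i using deg_aboveD g that by auto
    ultimately have "(\<exists>r\<in>carrier R. r \<noteq> \<zero>\<^bsub>R\<^esub> \<and> (\<forall>i. ?a i \<otimes>\<^bsub>R\<^esub> r = \<zero>\<^bsub>R\<^esub>)) \<and>
        (\<exists>s\<in>carrier R. s \<noteq> \<zero>\<^bsub>R\<^esub> \<and> (\<forall>j. s \<otimes>\<^bsub>R\<^esub> ?b j = \<zero>\<^bsub>R\<^esub>))"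
      by (rule ann)
    then obtain r s where r: "r \<in> carrier R" "r \<noteq> \<zero>\<^bsub>R\<^esub>" "\<And>i. ?a i \<otimes>\<^bsub>R\<^esub> r = \<zero>\<^bsub>R\<^esub>"
      and s: "s \<in> carrier R" "s \<noteq> \<zero>\<^bsub>R\<^esub>" "\<And>j. s \<otimes>\<^bsub>R\<^esub> ?b j = \<zero>\<^bsub>R\<^esub>"
      by blast
    have "f \<otimes>\<^bsub>UP R\<^esub> monom (UP R) r 0 = \<zero>\<^bsub>UP R\<^esub>"
    proof (rule up_eqI)
      fix k
      have "(\<Oplus>\<^bsub>R\<^esub>i\<in>{..k}. ?a i \<otimes>\<^bsub>R\<^esub> coeff (UP R) (monom (UP R) r 0) (k - i)) = (\<Oplus>\<^bsub>R\<^esub>i\<in>{..k}. \<zero>\<^bsub>R\<^esub>)"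
        using f r by (intro R.finsum_cong') auto
      then show "coeff (UP R) (f \<otimes>\<^bsub>UP R\<^esub> monom (UP R) r 0) k = coeff (UP R) \<zero>\<^bsub>UP R\<^esub> k"
        using f r by (simp del: coeff_monom)
    qed (use f r in auto)
    moreover have "monom (UP R) s 0 \<otimes>\<^bsub>UP R\<^esub> g = \<zero>\<^bsub>UP R\<^esub>"
    proof (rule up_eqI)
      fix k
      have "(\<Oplus>\<^bsub>R\<^esub>i\<in>{..k}. coeff (UP R) (monom (UP R) s 0) i \<otimes>\<^bsub>R\<^esub> ?b (k - i)) = (\<Oplus>\<^bsub>R\<^esub>i\<in>{..k}. \<zero>\<^bsub>R\<^esub>)"
        using g s by (intro R.finsum_cong') auto
      then show "coeff (UP R) (monom (UP R) s 0 \<otimes>\<^bsub>UP R\<^esub> g) k = coeff (UP R) \<zero>\<^bsub>UP R\<^esub> k"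
        using g s by (simp del: coeff_monom)
    qed (use g s in auto)
    ultimately show ?thesis using r s by blast
  qed
  then show ?thesis unfolding mccoy_def right_mccoy_def left_mccoy_def by blast
qed

theorem theorem2:
  fixes R :: "('a, 'm) ring_scheme"
  assumes "ring R" and "one_sided_duo R"
  shows "mccoy R"
proof (cases "right_duo R")
  case True
  interpret right_duo_ring R
    using True assms(1) by (simp add: right_duo_ring_def right_duo_ring_axioms_def)
  show ?thesis
    by (rule mccoy_if_coefficients[OF assms(1)],
        rule conjI[OF left_factor_annihilated right_factor_annihilated])
next
  case False
  then have "left_duo R" using assms(2) by (simp add: one_sided_duo_def)
  then interpret op: right_duo_ring "opposite R"
    using assms(1) right_duo_opposite ring_opposite
    by (auto simp: right_duo_ring_def right_duo_ring_axioms_def)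
  show ?thesis
  proof (intro mccoy_if_coefficients assms(1) conjI)
    fix a b :: "nat \<Rightarrow> 'a" and m n
    assume "ring.convolution_zero R a b" and nz: "\<exists>i. a i \<noteq> \<zero>\<^bsub>R\<^esub>" "\<exists>j. b j \<noteq> \<zero>\<^bsub>R\<^esub>"
      and fin: "\<And>i. m \<le> i \<Longrightarrow> a i = \<zero>\<^bsub>R\<^esub>" "\<And>j. n \<le> j \<Longrightarrow> b j = \<zero>\<^bsub>R\<^esub>"
    then have conv: "op.convolution_zero b a"
      using ring.convolution_zero_opposite[OF assms(1)] by blast
    show "\<exists>r\<in>carrier R. r \<noteq> \<zero>\<^bsub>R\<^esub> \<and> (\<forall>i. a i \<otimes>\<^bsub>R\<^esub> r = \<zero>\<^bsub>R\<^esub>)"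
      using op.right_factor_annihilated[OF conv, of n m] nz fin by simp
    show "\<exists>s\<in>carrier R. s \<noteq> \<zero>\<^bsub>R\<^esub> \<and> (\<forall>j. s \<otimes>\<^bsub>R\<^esub> b j = \<zero>\<^bsub>R\<^esub>)"
      using op.left_factor_annihilated[OF conv, of n m] nz fin by simp
  qed
qed

end
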